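(* The Least Unpopular (LU) procedure, for elections with at least three alternatives, satisfies the social disappointment criterion (SDC), the always-a-winner condition (AAW), and monotonicity. That is, for every finite set $A$ with $|A|\ge 3$ and every positive integer $n$, the rule $V=\mathrm{LU}$ on $(A,n)$-profiles satisfies SDC, AAW and monotonicity.
   Context: A ballot is a linear ordering of the finite set $A$ of alternatives (a strict ranking without ties). An $(A,n)$-profile $P$ is an $n$-tuple of ballots, one for each voter in $N=\{1,\dots,n\}$. A voting rule $V$ assigns to each $(A,n)$-profile $P$ a subset $V(P)\subseteq A$. LU: for $x\in A$ let $lp(x)$ be the number of voters who rank $x$ last in $P$. Then $\mathrm{LU}(P)$ is the set of all $x\in A$ for which $lp(x)$ is minimum over $A$. SDC: for every profile $P$ and every $x\in A$, if at least $n/2$ of the $n$ voters rank $x$ last, then $x\notin V(P)$. AAW: $V(P)\neq\emptyset$ for every profile $P$. Monotonicity: whenever $x\in V(P)$ and $Q$ is obtained from $P$ by one voter moving $x$ up on his or her ballot (all other ballots, and the relative order of the other alternatives on that voter's ballot, being unchanged), then $x\in V(Q)$. *)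

theory Defs
  imports Complex_Main "HOL-Library.FuncSet"
begin

text \<open>
  A ballot is a reflexive linear order on the alternatives \<open>A\<close>, read upwards:
  \<open>(x, y) \<in> r\<close> means that \<open>y\<close> is \<open>x\<close> or is ranked above \<open>x\<close>.
\<close>

definition ballots :: "'a set \<Rightarrow> 'a rel set" where
  "ballots A = {r. linear_order_on A r}"

text \<open>The \<open>n\<close>-tuples of ballots are the extensional functions on the set of voters \<open>{1..n}\<close>.\<close>

type_synonym 'a profile = "nat \<Rightarrow> 'a rel"

definition profiles :: "'a set \<Rightarrow> nat \<Rightarrow> 'a profile set" where
  "profiles A n = {1..n} \<rightarrow>\<^sub>E ballots A"

definition ranked_last :: "'a set \<Rightarrow> 'a rel \<Rightarrow> 'a \<Rightarrow> bool" where
  "ranked_last A r x \<longleftrightarrow> x \<in> A \<and> (\<forall>y\<in>A. (x, y) \<in> r)"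

definition lp :: "'a set \<Rightarrow> nat \<Rightarrow> 'a profile \<Rightarrow> 'a \<Rightarrow> nat" where
  "lp A n P x = card {i \<in> {1..n}. ranked_last A (P i) x}"

definition LU :: "'a set \<Rightarrow> nat \<Rightarrow> 'a profile \<Rightarrow> 'a set" where
  "LU A n P = {x \<in> A. \<forall>y\<in>A. lp A n P x \<le> lp A n P y}"

definition SDC :: "'a set \<Rightarrow> nat \<Rightarrow> ('a profile \<Rightarrow> 'a set) \<Rightarrow> bool" where
  "SDC A n V \<longleftrightarrow>
    (\<forall>P \<in> profiles A n. \<forall>x\<in>A. real (lp A n P x) \<ge> real n / 2 \<longrightarrow> x \<notin> V P)"

definition AAW :: "'a set \<Rightarrow> nat \<Rightarrow> ('a profile \<Rightarrow> 'a set) \<Rightarrow> bool" where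
  "AAW A n V \<longleftrightarrow> (\<forall>P \<in> profiles A n. V P \<noteq> {})"

text \<open>
  Moving \<open>x\<close> up is strict: the set of alternatives ranked at or below \<open>x\<close> grows properly.
  The distance is arbitrary, so \<open>x\<close> may pass several alternatives at once.
\<close>

definition moved_up :: "'a set \<Rightarrow> 'a \<Rightarrow> 'a rel \<Rightarrow> 'a rel \<Rightarrow> bool" where
  "moved_up A x r s \<longleftrightarrow>
    (\<forall>y\<in>A - {x}. \<forall>z\<in>A - {x}. (y, z) \<in> s \<longleftrightarrow> (y, z) \<in> r) \<and>
    {y\<in>A. (y, x) \<in> r} \<subset> {y\<in>A. (y, x) \<in> s}"

definition monotonic :: "'a set \<Rightarrow> nat \<Rightarrow> ('a profile \<Rightarrow> 'a set) \<Rightarrow> bool" where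
  "monotonic A n V \<longleftrightarrow>
    (\<forall>P \<in> profiles A n. \<forall>Q \<in> profiles A n. \<forall>x\<in>A. \<forall>i\<in>{1..n}.
      x \<in> V P \<longrightarrow> moved_up A x (P i) (Q i) \<longrightarrow> (\<forall>j\<in>{1..n} - {i}. Q j = P j) \<longrightarrow> x \<in> V Q)"

end

theory Submission
  imports Defs
begin

text \<open>A ballot has at most one last alternative, so the values of \<open>lp\<close> sum to at
  most \<open>n\<close> (\<open>sum_lp_le\<close>). A winner attains the minimum of
  \<open>lp\<close>, so with at least three alternatives its value is at most n/3, below the n/2
  that SDC forbids. A winner exists because a finite nonempty set of numbers has a minimum. For
  monotonicity, raising \<open>x\<close> on one ballot cannot increase \<open>lp\<close> of
  \<open>x\<close> (\<open>moved_up_not_ranked_last\<close>) and cannot decrease \<open>lp\<close>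
  of any other alternative (\<open>moved_up_ranked_last\<close>), so \<open>x\<close> stays
  minimal.\<close>

lemma ranked_last_unique:
  assumes "r \<in> ballots A" "ranked_last A r x" "ranked_last A r y"
  shows "x = y"
  using assms
  by (auto simp: ballots_def ranked_last_def linear_order_on_def partial_order_on_def antisym_def)

text \<open>Double counting: the sets of voters who rank a given alternative last are pairwise
  disjoint by \<open>ranked_last_unique\<close>, and their union lies in
  \<open>{1..n}\<close>.\<close>

lemma sum_lp_le:
  assumes "finite A" "P \<in> profiles A n"
  shows "(\<Sum>x\<in>A. lp A n P x) \<le> n"
proof -
  let ?L = "\<lambda>x. {i \<in> {1..n}. ranked_last A (P i) x}"
  have "?L x \<inter> ?L y = {}" if "x \<noteq> y" for x y
    using that assms(2) ranked_last_unique by (fastforce simp: profiles_def)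
  then have "(\<Sum>x\<in>A. lp A n P x) = card (\<Union>x\<in>A. ?L x)"
    unfolding lp_def using assms(1) by (subst card_UN_disjoint) auto
  also have "\<dots> \<le> card {1..n}"
    by (rule card_mono) auto
  finally show ?thesis by simp
qed

lemma SDC_LU:
  assumes "finite A" "card A \<ge> 3" "n \<ge> 1"
  shows "SDC A n (LU A n)"
  unfolding SDC_def
proof (intro ballI impI notI)
  fix P x
  assume P: "P \<in> profiles A n" and half: "real (lp A n P x) \<ge> real n / 2"
    and x: "x \<in> LU A n P"
  have "3 * lp A n P x \<le> card A * lp A n P x"
    using assms(2) by (rule mult_right_mono) simp
  also have "\<dots> \<le> (\<Sum>y\<in>A. lp A n P y)"
    using sum_bounded_below[of A "lp A n P x" "lp A n P"] x by (simp add: LU_def)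
  also have "\<dots> \<le> n"
    using assms(1) P by (rule sum_lp_le)
  \<comment> \<open>The chain gives \<open>3 * lp A n P x \<le> n\<close>; together with
    \<open>half\<close> this forces 3n/2 \<le> n, impossible for a positive n.\<close>
  finally show False
    using half assms(3) by linarith
qed

lemma AAW_LU:
  assumes "finite A" "A \<noteq> {}"
  shows "AAW A n (LU A n)"
  unfolding AAW_def
proof
  fix P
  have "Min (lp A n P ` A) \<in> lp A n P ` A"
    using assms by (intro Min_in) auto
  then obtain x where "x \<in> A" "lp A n P x = Min (lp A n P ` A)"
    by force
  then have "x \<in> LU A n P"
    using assms(1) by (simp add: LU_def)
  then show "LU A n P \<noteq> {}" by blast
qed

lemma moved_up_not_ranked_last:
  assumes "r \<in> ballots A" "s \<in> ballots A" "x \<in> A" "moved_up A x r s"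
  shows "\<not> ranked_last A s x"
proof
  assume last: "ranked_last A s x"
  \<comment> \<open>The inclusion in \<open>moved_up\<close> is strict, so \<open>x\<close>
    overtakes some \<open>y\<close>; reflexivity of \<open>r\<close> makes this \<open>y\<close>
    different from \<open>x\<close>, and it now lies below \<open>x\<close>.\<close>
  obtain y where y: "y \<in> A" "(y, x) \<in> s" "(y, x) \<notin> r"
    using assms(4) by (auto simp: moved_up_def)
  have "(x, y) \<in> s"
    using last y(1) by (simp add: ranked_last_def)
  then have "y = x"
    using assms(2) y(2)
    by (auto simp: ballots_def linear_order_on_def partial_order_on_def antisym_def)
  moreover have "(x, x) \<in> r"
    using assms(1,3)
    by (auto simp: ballots_def linear_order_on_def partial_order_on_def preorder_on_def refl_on_def)
  ultimately show False using y(3) by simp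
qed

text \<open>Against \<open>z\<close> other than \<open>x\<close> the order is unchanged; against
  \<open>x\<close> itself, \<open>y\<close> stays below because the set of alternatives at or below
  \<open>x\<close> only grows.\<close>

lemma moved_up_ranked_last:
  assumes "s \<in> ballots A" "moved_up A x r s" "y \<noteq> x" "ranked_last A r y"
  shows "ranked_last A s y"
  unfolding ranked_last_def
proof (intro conjI ballI)
  show "y \<in> A"
    using assms(4) by (simp add: ranked_last_def)
  fix z assume "z \<in> A"
  then show "(y, z) \<in> s"
    using assms by (cases "z = x") (auto simp: moved_up_def ranked_last_def)
qed

lemma monotonic_LU: "monotonic A n (LU A n)"
  unfolding monotonic_def
proof (intro ballI impI)
  fix P Q x i
  assume P: "P \<in> profiles A n" and Q: "Q \<in> profiles A n" and x: "x \<in> A" and i: "i \<in> {1..n}"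
    and win: "x \<in> LU A n P" and up: "moved_up A x (P i) (Q i)"
    and same: "\<forall>j\<in>{1..n} - {i}. Q j = P j"
  have Pi: "P i \<in> ballots A" and Qi: "Q i \<in> ballots A"
    using P Q i by (auto simp: profiles_def)
  \<comment> \<open>For \<open>j = i\<close> the premise is contradictory, since voter
    \<open>i\<close> no longer ranks \<open>x\<close> last; every other ballot is the same in
    \<open>P\<close> and \<open>Q\<close>.\<close>
  have "ranked_last A (P j) x" if "j \<in> {1..n}" "ranked_last A (Q j) x" for j
    using that same moved_up_not_ranked_last[OF Pi Qi x up] by (cases "j = i") auto
  then have dec: "lp A n Q x \<le> lp A n P x"
    unfolding lp_def by (intro card_mono) auto
  have "lp A n Q x \<le> lp A n Q y" if "y \<in> A" for y
  proof (cases "y = x")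
    case False
    have "ranked_last A (Q j) y" if "j \<in> {1..n}" "ranked_last A (P j) y" for j
      using that same moved_up_ranked_last[OF Qi up False] by (cases "j = i") auto
    then have "lp A n P y \<le> lp A n Q y"
      unfolding lp_def by (intro card_mono) auto
    moreover have "lp A n P x \<le> lp A n P y"
      using win \<open>y \<in> A\<close> by (simp add: LU_def)
    ultimately show ?thesis using dec by linarith
  qed simp
  then show "x \<in> LU A n Q"
    using x by (simp add: LU_def)
qed

theorem proposition4:
  fixes A :: "'a set" and n :: nat
  assumes "finite A" and "card A \<ge> 3" and "n \<ge> 1"
  shows "SDC A n (LU A n) \<and> AAW A n (LU A n) \<and> monotonic A n (LU A n)"
proof -
  have "A \<noteq> {}" using assms(2) by auto
  then show ?thesis
    using SDC_LU AAW_LU monotonic_LU assms by blast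
qed

end
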